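(* Let $n\ge1$, let $$\widetilde L_n=\{(b,S): b\in\Delta_n,\ \varnothing\ne S\subseteq\mathrm{supp}(b)\},$$ and let $\pi:\widetilde L_n\to L_n$, $\pi(b,S)=T(b,S)$. The cyclic group $C_3=\langle\tau\rangle$ of order $3$ acts on $\widetilde L_n$ by $$\tau\cdot(b,S)=(\gamma_S(b),S).$$ This action is free (every stabilizer is trivial). For each $T\in L_n$, the three representatives sent to $T$ by $\pi$ form exactly one $C_3$-orbit. Consequently, the $C_3$-orbits of $\widetilde L_n$ are in bijection with $L_n$. More generally, if $A\subseteq\widetilde L_n$ is a union of $C_3$-orbits (equivalently, $C_3$-invariant), then $$|\pi(A)|=\frac{|A|}{3}.$$
   Context: $\Delta_n=\{i,j,k,e\}^n$ is the set of words $b=b_1b_2\cdots b_n$ of length $n$ in the four symbols $i,j,k,e$. For $b\in\Delta_n$ put $\mathrm{supp}(b)=\{r\in\{1,\dots,n\}: b_r\ne e\}$. Let $\gamma$ be the permutation $i\mapsto j\mapsto k\mapsto i$, $e\mapsto e$. For a nonempty set $S\subseteq\mathrm{supp}(b)$, $\gamma_S(b)$ is the word obtained by applying $\gamma$ in the coordinates of $S$ and fixing the other coordinates, and $T(b,S)=\{b,\gamma_S(b),\gamma_S^2(b)\}$ (an unordered set of words). The local class is $L_n=\{T(b,S): b\in\Delta_n,\ \varnothing\ne S\subseteq\mathrm{supp}(b)\}$. *)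

theory Defs
  imports Complex_Main "HOL-Algebra.Group_Action" "HOL-Algebra.Elementary_Groups"
begin

datatype letter = sym_i | sym_j | sym_k | sym_e

fun cyc :: "letter \<Rightarrow> letter" where
  "cyc sym_i = sym_j"
| "cyc sym_j = sym_k"
| "cyc sym_k = sym_i"
| "cyc sym_e = sym_e"

type_synonym word = "letter list"

definition Delta :: "nat \<Rightarrow> word set" where
  "Delta n = {b. length b = n}"

text \<open>Coordinates are numbered from 1: the coordinate \<open>r\<close> of \<open>b\<close> is the list entry \<open>b ! (r - 1)\<close>.\<close>

definition supp :: "word \<Rightarrow> nat set" where
  "supp b = {r \<in> {1..length b}. b ! (r - 1) \<noteq> sym_e}"

definition cyc_on :: "nat set \<Rightarrow> word \<Rightarrow> word" where
  "cyc_on S b = map (\<lambda>r. if r \<in> S then cyc (b ! (r - 1)) else b ! (r - 1)) [1..<length b + 1]"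

definition triple :: "word \<Rightarrow> nat set \<Rightarrow> word set" where
  "triple b S = {b, cyc_on S b, cyc_on S (cyc_on S b)}"

definition local_class :: "nat \<Rightarrow> word set set" where
  "local_class n = {triple b S | b S. b \<in> Delta n \<and> S \<noteq> {} \<and> S \<subseteq> supp b}"

definition local_reps :: "nat \<Rightarrow> (word \<times> nat set) set" where
  "local_reps n = {(b, S). b \<in> Delta n \<and> S \<noteq> {} \<and> S \<subseteq> supp b}"

definition proj :: "word \<times> nat set \<Rightarrow> word set" where
  "proj = (\<lambda>(b, S). triple b S)"

text \<open>The group \<open>C\<^sub>3\<close> is written additively as \<open>{0, 1, 2}\<close> modulo 3, with the generator \<open>\<tau>\<close> being 1.\<close>

abbreviation C3 :: "int monoid" where
  "C3 \<equiv> integer_mod_group 3"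

definition tau_map :: "word \<times> nat set \<Rightarrow> word \<times> nat set" where
  "tau_map = (\<lambda>(b, S). (cyc_on S b, S))"

text \<open>The element \<open>m\<close> of \<open>C3\<close>, that is \<open>\<tau>\<close> to the power \<open>m\<close>, acts as the \<open>m\<close>-fold iterate of
  \<^const>\<open>tau_map\<close>. The restriction is there because \<^const>\<open>group_action\<close> asks for extensional
  functions.\<close>

definition rot :: "nat \<Rightarrow> int \<Rightarrow> word \<times> nat set \<Rightarrow> word \<times> nat set" where
  "rot n m = restrict (tau_map ^^ nat m) (local_reps n)"

end

theory Submission
  imports Defs
begin

text \<open>
  The point is that the triple \<open>T = {b, \<gamma>\<^sub>S b, \<gamma>\<^sub>S\<^sup>2 b}\<close> remembers the set \<open>S\<close>.  Since
  \<open>\<gamma>\<close> has no fixed point among \<open>i\<close>, \<open>j\<close>, \<open>k\<close> and \<open>S\<close> lies in the support of \<open>b\<close>, the words of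
  \<open>T\<close> disagree at each coordinate of \<open>S\<close>, and they agree at every other coordinate; so \<open>S\<close> is the set of
  coordinates at which \<open>T\<close> is not constant (\<open>disagreement_triple\<close>).  Hence if
  \<open>T(c, S') = T(b, S)\<close>, then \<open>S' = S\<close>, and \<open>c\<close>, being a word of \<open>T\<close>, is one of the rotations of \<open>b\<close>
  by \<open>\<gamma>\<^sub>S\<close>.  Conversely a rotation of \<open>b\<close> has the same triple, because \<open>\<gamma>\<^sub>S\<^sup>3 = id\<close>.
  Therefore the fibres of \<open>\<pi>\<close> are exactly the orbits of \<open>\<tau>\<close> (\<open>fibre_proj\<close>).

  The same disagreement shows that \<open>\<tau>\<close> moves every pair \<open>(b, S)\<close>; as the order of \<open>\<tau>\<close> is the prime 3,
  the action is free and all orbits have three elements.  The bijection between orbits and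
  local classes is then induced by \<open>\<pi>\<close>, and an invariant set \<open>A\<close>, being a union of fibres of size three,
  satisfies \<open>|A| = 3 |\<pi>(A)|\<close>.
\<close>

section \<open>Invariant sets and uniform fibres\<close>

lemma (in group_action) union_of_orbits_iff_invariant:
  assumes "A \<subseteq> E"
  shows "(\<exists>U \<subseteq> orbits G E \<phi>. A = \<Union>U) \<longleftrightarrow> (\<forall>g \<in> carrier G. \<phi> g ` A = A)"
proof
  assume "\<exists>U \<subseteq> orbits G E \<phi>. A = \<Union>U"
  then obtain U where U: "U \<subseteq> orbits G E \<phi>" "A = \<Union>U" by blast
  have closed: "\<phi> g y \<in> A" if y: "y \<in> A" and g: "g \<in> carrier G" for g y
  proof -
    obtain x where x: "x \<in> E" "orbit G \<phi> x \<in> U" "y \<in> orbit G \<phi> x"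
    proof -
      obtain Ob where "y \<in> Ob" "Ob \<in> U" using y U by blast
      moreover obtain x where "x \<in> E" "Ob = orbit G \<phi> x"
        using U \<open>Ob \<in> U\<close> unfolding orbits_def by blast
      ultimately show thesis using that by blast
    qed
    have "y \<in> E" using y assms by blast
    moreover have "\<phi> g y \<in> orbit G \<phi> y" using g unfolding orbit_def by blast
    ultimately have "\<phi> g y \<in> orbit G \<phi> x"
      using orbit_trans[OF x(1) _ element_image[OF g _ refl] x(3)] by simp
    then show ?thesis using x U by blast
  qed
  interpret group G using group_hom group_hom.axioms(1) by auto
  show "\<forall>g \<in> carrier G. \<phi> g ` A = A"
  proof
    fix g assume g: "g \<in> carrier G"
    have "y \<in> \<phi> g ` A" if "y \<in> A" for y
    proof
      show "\<phi> (inv g) y \<in> A" using closed[OF that inv_closed[OF g]] .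
      show "y = \<phi> g (\<phi> (inv g) y)"
        using orbit_sym_aux[OF inv_closed[OF g], of y] that assms g by force
    qed
    then show "\<phi> g ` A = A" using closed g by blast
  qed
next
  assume inv: "\<forall>g \<in> carrier G. \<phi> g ` A = A"
  have "A = \<Union>(orbit G \<phi> ` A)"
  proof
    show "A \<subseteq> \<Union>(orbit G \<phi> ` A)" using orbit_refl assms by blast
    show "\<Union>(orbit G \<phi> ` A) \<subseteq> A" using inv unfolding orbit_def by blast
  qed
  moreover have "orbit G \<phi> ` A \<subseteq> orbits G E \<phi>" using assms unfolding orbits_def by blast
  ultimately show "\<exists>U \<subseteq> orbits G E \<phi>. A = \<Union>U" by blast
qed

lemma card_eq_mult_card_image:
  assumes "finite A" and "\<And>y. y \<in> f ` A \<Longrightarrow> card {x \<in> A. f x = y} = k"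
  shows "card A = k * card (f ` A)"
  using sum.image_gen[OF assms(1), of "\<lambda>_. 1::nat" f] assms(2) by simp

section \<open>A triple determines its set of coordinates\<close>

lemma cyc_cyc_cyc [simp]: "cyc (cyc (cyc x)) = x"
  by (cases x) auto

lemma cyc_eq_self_iff [simp]: "cyc x = x \<longleftrightarrow> x = sym_e"
  by (cases x) auto

lemma cyc_eq_sym_e_iff [simp]: "cyc x = sym_e \<longleftrightarrow> x = sym_e"
  by (cases x) auto

lemma length_cyc_on [simp]: "length (cyc_on S b) = length b"
  by (simp add: cyc_on_def del: upt_Suc)

lemma nth_cyc_on:
  "i < length b \<Longrightarrow> cyc_on S b ! i = (if Suc i \<in> S then cyc (b ! i) else b ! i)"
  by (simp add: cyc_on_def del: upt_Suc)

lemma cyc_on_cube [simp]: "cyc_on S (cyc_on S (cyc_on S b)) = b"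
  by (rule nth_equalityI) (auto simp: nth_cyc_on)

lemma supp_cyc_on [simp]: "supp (cyc_on S b) = supp b"
  by (auto simp: supp_def nth_cyc_on split: if_splits)

lemma triple_cyc_on [simp]: "triple (cyc_on S b) S = triple b S"
  by (auto simp: triple_def)

definition disagreement :: "nat \<Rightarrow> word set \<Rightarrow> nat set" where
  "disagreement n T = {r \<in> {1..n}. \<exists>w \<in> T. \<exists>w' \<in> T. w ! (r - 1) \<noteq> w' ! (r - 1)}"

text \<open>On \<open>S\<close> the words \<open>b\<close> and \<open>\<gamma>\<^sub>S b\<close> already differ, because \<open>\<gamma>\<close> moves each letter other
  than \<open>e\<close>; off \<open>S\<close> no rotation changes anything.\<close>

lemma disagreement_triple:
  assumes "length b = n" "S \<subseteq> supp b"
  shows "disagreement n (triple b S) = S"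
proof
  show "disagreement n (triple b S) \<subseteq> S"
  proof
    fix r assume "r \<in> disagreement n (triple b S)"
    then have "r \<in> {1..n}" "\<exists>w \<in> triple b S. \<exists>w' \<in> triple b S. w ! (r - 1) \<noteq> w' ! (r - 1)"
      by (simp_all add: disagreement_def)
    moreover have "w ! (r - 1) = b ! (r - 1)" if "w \<in> triple b S" "r \<notin> S" for w
      using that \<open>r \<in> {1..n}\<close> assms(1) by (cases r) (auto simp: triple_def nth_cyc_on)
    ultimately show "r \<in> S" by metis
  qed
  show "S \<subseteq> disagreement n (triple b S)"
  proof
    fix r assume r: "r \<in> S"
    then have s: "r \<in> {1..n}" "b ! (r - 1) \<noteq> sym_e" using assms by (auto simp: supp_def)
    then have "cyc_on S b ! (r - 1) \<noteq> b ! (r - 1)"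
      using r assms(1) by (cases r) (auto simp: nth_cyc_on)
    then show "r \<in> disagreement n (triple b S)"
      using s unfolding disagreement_def triple_def by blast
  qed
qed

section \<open>The free action of order three\<close>

lemma tau_map_cube [simp]: "tau_map (tau_map (tau_map x)) = x"
  by (simp add: tau_map_def split_beta)

lemma tau_map_in_local_reps: "x \<in> local_reps n \<Longrightarrow> tau_map x \<in> local_reps n"
  by (auto simp: tau_map_def local_reps_def Delta_def)

text \<open>If \<open>\<tau>\<close> fixed \<open>(b, S)\<close>, the triple would be a single word, with empty disagreement set,
  whereas \<open>S\<close> is nonempty.\<close>

lemma tau_map_ne:
  assumes "x \<in> local_reps n"
  shows "tau_map x \<noteq> x"
proof
  assume fixed: "tau_map x = x"
  obtain b S where x: "x = (b, S)" by fastforce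
  from assms x have S: "length b = n" "S \<noteq> {}" "S \<subseteq> supp b"
    by (auto simp: local_reps_def Delta_def)
  from fixed x have "triple b S = {b}" by (simp add: tau_map_def triple_def)
  then have "disagreement n (triple b S) = {}" by (simp add: disagreement_def)
  with disagreement_triple S show False by simp
qed

text \<open>If \<open>\<tau>\<^sup>2\<close> fixed \<open>x\<close>, then so would \<open>(\<tau>\<^sup>2)\<^sup>2 = \<tau>\<close>.\<close>

lemma tau_map_tau_map_ne: "x \<in> local_reps n \<Longrightarrow> tau_map (tau_map x) \<noteq> x"
  using tau_map_ne tau_map_cube by metis

lemma finite_local_reps: "finite (local_reps n)"
proof -
  have "finite (UNIV :: letter set)"
    by (rule finite_subset[of _ "{sym_i, sym_j, sym_k, sym_e}"]) (auto intro: letter.exhaust)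
  then have "finite {b :: word. set b \<subseteq> UNIV \<and> length b = n}"
    by (rule finite_lists_length_eq)
  then have "finite (Delta n \<times> Pow {1..n})" by (simp add: Delta_def)
  moreover have "local_reps n \<subseteq> Delta n \<times> Pow {1..n}"
    by (auto simp: local_reps_def Delta_def supp_def)
  ultimately show ?thesis by (rule finite_subset[rotated])
qed

lemma carrier_C3: "carrier C3 = {0, 1, 2}"
  by (auto simp: carrier_integer_mod_group)

lemma rot_apply [simp]:
  assumes "x \<in> local_reps n"
  shows "rot n 0 x = x" "rot n 1 x = tau_map x" "rot n 2 x = tau_map (tau_map x)"
  using assms by (simp_all add: rot_def numeral_2_eq_2)

lemma funpow_tau_map_in_local_reps:
  "x \<in> local_reps n \<Longrightarrow> (tau_map ^^ m) x \<in> local_reps n"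
  by (induction m) (auto simp: tau_map_in_local_reps)

text \<open>This is why reducing sums modulo 3 in \<open>C\<^sub>3\<close> is compatible with composing rotations.\<close>

lemma funpow_tau_map_mod_3: "tau_map ^^ (m mod 3) = tau_map ^^ m"
proof
  fix x
  have "(tau_map ^^ 3) x = x" by (simp add: numeral_3_eq_3)
  then show "(tau_map ^^ (m mod 3)) x = (tau_map ^^ m) x" by (rule funpow_mod_eq)
qed

lemma rot_in_Bij: "rot n m \<in> Bij (local_reps n)"
proof -
  have "bij_betw (tau_map ^^ nat m) (local_reps n) (local_reps n)"
  proof (rule bij_betwI)
    \<comment> \<open>As \<open>\<tau>\<^sup>3 = id\<close>, the power \<open>\<tau>\<^bsup>2m\<^esup>\<close> is the inverse of \<open>\<tau>\<^bsup>m\<^esup>\<close>.\<close>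
    have "(tau_map ^^ (2 * nat m + nat m)) x = x" for x
      using funpow_tau_map_mod_3[of "3 * nat m"] by simp
    then show "(tau_map ^^ (2 * nat m)) ((tau_map ^^ nat m) x) = x"
      "(tau_map ^^ nat m) ((tau_map ^^ (2 * nat m)) x) = x" for x
      by (metis add.commute comp_apply funpow_add)+
  qed (auto simp: funpow_tau_map_in_local_reps)
  then show ?thesis
    unfolding Bij_def rot_def by (simp cong: bij_betw_cong)
qed

lemma rot_action: "group_action C3 (local_reps n) (rot n)"
proof -
  have "rot n ((g + h) mod 3) = compose (local_reps n) (rot n g) (rot n h)"
    if "g \<in> carrier C3" "h \<in> carrier C3" for g h
  proof
    fix x
    have "nat ((g + h) mod 3) = (nat g + nat h) mod 3"
      using that by (auto simp: carrier_C3 nat_mod_distrib)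
    then have "tau_map ^^ nat ((g + h) mod 3) = tau_map ^^ nat g \<circ> tau_map ^^ nat h"
      by (simp add: funpow_tau_map_mod_3 funpow_add)
    then show "rot n ((g + h) mod 3) x = compose (local_reps n) (rot n g) (rot n h) x"
      by (simp add: rot_def compose_def funpow_tau_map_in_local_reps)
  qed
  then have "rot n \<in> hom C3 (BijGroup (local_reps n))"
    by (simp add: hom_def BijGroup_def rot_in_Bij)
  then show ?thesis
    by (simp add: group_action_def group_hom_def group_hom_axioms_def group_BijGroup)
qed

lemma rot_free:
  assumes "x \<in> local_reps n"
  shows "stabilizer C3 (rot n) x = {\<one>\<^bsub>C3\<^esub>}"
proof -
  have "rot n 1 x \<noteq> x" "rot n 2 x \<noteq> x" "rot n 0 x = x"
    using assms tau_map_ne tau_map_tau_map_ne by simp_all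
  then show ?thesis by (auto simp: stabilizer_def carrier_C3 simp del: rot_apply)
qed

lemma orbit_rot:
  assumes "x \<in> local_reps n"
  shows "orbit C3 (rot n) x = {x, tau_map x, tau_map (tau_map x)}"
proof -
  have "orbit C3 (rot n) x = (\<lambda>g. rot n g x) ` carrier C3" by (auto simp: orbit_def)
  then show ?thesis using assms unfolding carrier_C3 image_insert image_empty by simp
qed

lemma card_orbit_rot:
  assumes "x \<in> local_reps n"
  shows "card (orbit C3 (rot n) x) = 3"
  using tau_map_ne[OF assms] tau_map_tau_map_ne[OF assms]
    tau_map_ne[OF tau_map_in_local_reps[OF assms]]
  by (simp add: orbit_rot[OF assms] not_sym)

section \<open>Orbits are the fibres of the projection\<close>

lemma local_class_eq: "local_class n = proj ` local_reps n"
  by (auto simp: local_class_def local_reps_def proj_def)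

text \<open>A second representative of the triple of \<open>(b, S)\<close> has the same set \<open>S\<close>, read off as the
  disagreement set, and its word is one of the three words of the triple.\<close>

lemma fibre_proj:
  assumes "x \<in> local_reps n"
  shows "{y \<in> local_reps n. proj y = proj x} = orbit C3 (rot n) x"
proof
  obtain b S where x: "x = (b, S)" by fastforce
  show "{y \<in> local_reps n. proj y = proj x} \<subseteq> orbit C3 (rot n) x"
  proof clarify
    fix c S' assume c: "(c, S') \<in> local_reps n" and eq: "proj (c, S') = proj x"
    then have T: "triple c S' = triple b S" by (simp add: x proj_def)
    have "S' = disagreement n (triple c S')" "S = disagreement n (triple b S)"
      using c assms by (auto simp: x local_reps_def Delta_def disagreement_triple)
    then have "S' = S" using T by simp
    moreover have "c \<in> triple b S" using T by (auto simp: triple_def)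
    ultimately show "(c, S') \<in> orbit C3 (rot n) x"
      by (auto simp: orbit_rot[OF assms[unfolded x]] x tau_map_def triple_def)
  qed
  show "orbit C3 (rot n) x \<subseteq> {y \<in> local_reps n. proj y = proj x}"
    using assms tau_map_in_local_reps
    by (auto simp: orbit_rot x proj_def tau_map_def)
qed

lemma bij_betw_orbits_local_class:
  "\<exists>f. bij_betw f (orbits C3 (local_reps n) (rot n)) (local_class n)
     \<and> (\<forall>x \<in> local_reps n. f (orbit C3 (rot n) x) = proj x)"
proof -
  \<comment> \<open>The projection is constant on an orbit, so its image there is a singleton.\<close>
  define f where "f = (\<lambda>Ob. the_elem (proj ` Ob))"
  have f: "f (orbit C3 (rot n) x) = proj x" if "x \<in> local_reps n" for x
  proof -
    have "proj ` {y \<in> local_reps n. proj y = proj x} = {proj x}" using that by auto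
    then show ?thesis by (simp add: f_def flip: fibre_proj[OF that])
  qed
  have "inj_on f (orbits C3 (local_reps n) (rot n))"
  proof (rule inj_onI)
    fix P Q assume "P \<in> orbits C3 (local_reps n) (rot n)" "Q \<in> orbits C3 (local_reps n) (rot n)"
    then obtain x y where x: "x \<in> local_reps n" "P = orbit C3 (rot n) x"
      and y: "y \<in> local_reps n" "Q = orbit C3 (rot n) y"
      unfolding orbits_def by blast
    assume "f P = f Q"
    then have "proj x = proj y" using x y f by simp
    then show "P = Q" using fibre_proj[OF x(1)] fibre_proj[OF y(1)] x(2) y(2) by simp
  qed
  moreover have "f ` orbits C3 (local_reps n) (rot n) = local_class n"
    by (auto simp: orbits_def local_class_eq f image_iff dest: f[symmetric])
  ultimately show ?thesis using f unfolding bij_betw_def by blast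
qed

lemma card_proj_image:
  assumes "U \<subseteq> orbits C3 (local_reps n) (rot n)"
  shows "card (\<Union>U) = 3 * card (proj ` \<Union>U)"
proof (rule card_eq_mult_card_image)
  have sub: "\<Union>U \<subseteq> local_reps n"
    using assms group_action.orbits_coverture[OF rot_action] by blast
  then show "finite (\<Union>U)" using finite_local_reps finite_subset by blast
  fix T assume "T \<in> proj ` \<Union>U"
  then obtain x Ob where x: "x \<in> Ob" "Ob \<in> U" "T = proj x" by blast
  then have rep: "x \<in> local_reps n" using sub by blast
  \<comment> \<open>The orbit through a point of the union belongs to the union, so the fibre over \<open>T\<close> lies in it.\<close>
  have "orbit C3 (rot n) x \<subseteq> \<Union>U"
  proof -
    have "x \<in> orbit C3 (rot n) x"
      using rep by (simp add: orbit_rot)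
    moreover have "orbit C3 (rot n) x \<in> orbits C3 (local_reps n) (rot n)"
      using rep unfolding orbits_def by blast
    ultimately have "Ob = orbit C3 (rot n) x"
      using group_action.disjoint_union[OF rot_action] x assms by blast
    then show ?thesis using x by blast
  qed
  then have "{y \<in> \<Union>U. proj y = T} = orbit C3 (rot n) x"
    using fibre_proj[OF rep] sub x(3) by blast
  then show "card {y \<in> \<Union>U. proj y = T} = 3"
    using card_orbit_rot[OF rep] by simp
qed

theorem proposition5p5:
  fixes n :: nat
  assumes "n \<ge> 1"
  shows "group_action C3 (local_reps n) (rot n)
    \<and> (\<forall>(b, S) \<in> local_reps n. rot n 1 (b, S) = (cyc_on S b, S))
    \<and> (\<forall>x \<in> local_reps n. stabilizer C3 (rot n) x = {\<one>\<^bsub>C3\<^esub>})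
    \<and> (\<forall>T \<in> local_class n.
          card {x \<in> local_reps n. proj x = T} = 3
        \<and> {x \<in> local_reps n. proj x = T} \<in> orbits C3 (local_reps n) (rot n))
    \<and> (\<exists>f. bij_betw f (orbits C3 (local_reps n) (rot n)) (local_class n)
        \<and> (\<forall>x \<in> local_reps n. f (orbit C3 (rot n) x) = proj x))
    \<and> (\<forall>A \<subseteq> local_reps n.
          ((\<exists>U \<subseteq> orbits C3 (local_reps n) (rot n). A = \<Union>U)
             \<longleftrightarrow> (\<forall>g \<in> carrier C3. rot n g ` A = A))
        \<and> ((\<exists>U \<subseteq> orbits C3 (local_reps n) (rot n). A = \<Union>U)
             \<longrightarrow> real (card (proj ` A)) = real (card A) / 3))"
proof (intro conjI)
  show "group_action C3 (local_reps n) (rot n)" by (rule rot_action)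
  show "\<forall>(b, S) \<in> local_reps n. rot n 1 (b, S) = (cyc_on S b, S)"
    by (auto simp: tau_map_def)
  show "\<forall>x \<in> local_reps n. stabilizer C3 (rot n) x = {\<one>\<^bsub>C3\<^esub>}"
    using rot_free by blast
  show "\<forall>T \<in> local_class n. card {x \<in> local_reps n. proj x = T} = 3
      \<and> {x \<in> local_reps n. proj x = T} \<in> orbits C3 (local_reps n) (rot n)"
    by (auto simp: local_class_eq fibre_proj card_orbit_rot orbits_def)
  show "\<exists>f. bij_betw f (orbits C3 (local_reps n) (rot n)) (local_class n)
      \<and> (\<forall>x \<in> local_reps n. f (orbit C3 (rot n) x) = proj x)"
    by (rule bij_betw_orbits_local_class)
  show "\<forall>A \<subseteq> local_reps n.
      ((\<exists>U \<subseteq> orbits C3 (local_reps n) (rot n). A = \<Union>U)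
         \<longleftrightarrow> (\<forall>g \<in> carrier C3. rot n g ` A = A))
    \<and> ((\<exists>U \<subseteq> orbits C3 (local_reps n) (rot n). A = \<Union>U)
         \<longrightarrow> real (card (proj ` A)) = real (card A) / 3)"
  proof (intro allI impI conjI)
    fix A assume "A \<subseteq> local_reps n"
    then show "(\<exists>U \<subseteq> orbits C3 (local_reps n) (rot n). A = \<Union>U)
        \<longleftrightarrow> (\<forall>g \<in> carrier C3. rot n g ` A = A)"
      by (rule group_action.union_of_orbits_iff_invariant[OF rot_action])
  next
    fix A assume "\<exists>U \<subseteq> orbits C3 (local_reps n) (rot n). A = \<Union>U"
    then have "card A = 3 * card (proj ` A)" by (elim exE conjE) (simp only: card_proj_image)
    then show "real (card (proj ` A)) = real (card A) / 3" by simp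
  qed
qed

end
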